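(* For every integer $n\ge 3$ with $n\ne 6$, $$R(B_{n-2},B_n)\le 4n-3.$$
   Context: For a positive integer $n$, the book graph $B_n=K_2+\overline{K}_n$ is the graph consisting of $n$ triangles sharing a common edge. The Ramsey number $R(B_m,B_n)$ is the smallest integer $N$ such that every red/blue coloring of the edges of $K_N$ contains a red copy of $B_m$ or a blue copy of $B_n$ (copies are as not necessarily induced subgraphs). *)

theory Defs
  imports "HOL-Library.Ramsey"
begin

text \<open>
  A simple graph is given by its vertex set and its set of edges, the latter being two-element
  sets of vertices; \<open>[V]\<^bsup>2\<^esup>\<close> denotes the set of all two-element subsets of \<open>V\<close>.
\<close>

record 'a sgraph =
  verts :: "'a set"
  edges :: "'a set set"

definition complete_graph :: "'a set \<Rightarrow> 'a sgraph" where
  "complete_graph V = \<lparr>verts = V, edges = [V]\<^bsup>2\<^esup>\<rparr>"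

definition complement_graph :: "'a sgraph \<Rightarrow> 'a sgraph" where
  "complement_graph G = \<lparr>verts = verts G, edges = [verts G]\<^bsup>2\<^esup> - edges G\<rparr>"

text \<open>The join \<open>G + H\<close>, on the disjoint union of the two vertex sets.\<close>

definition graph_join :: "'a sgraph \<Rightarrow> 'b sgraph \<Rightarrow> ('a + 'b) sgraph" where
  "graph_join G H =
     \<lparr>verts = verts G <+> verts H,
      edges = (\<lambda>e. Inl ` e) ` edges G \<union> (\<lambda>e. Inr ` e) ` edges H
        \<union> {{Inl u, Inr v} | u v. u \<in> verts G \<and> v \<in> verts H}\<rparr>"

definition book_graph :: "nat \<Rightarrow> (nat + nat) sgraph" where
  "book_graph n =
     graph_join (complete_graph {..<2}) (complement_graph (complete_graph {..<n}))"

text \<open>\<open>G\<close> contains a copy of \<open>H\<close> as a not necessarily induced subgraph.\<close>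

definition contains_copy :: "'a sgraph \<Rightarrow> 'b sgraph \<Rightarrow> bool" where
  "contains_copy G H \<longleftrightarrow>
     (\<exists>f. inj_on f (verts H) \<and> f ` verts H \<subseteq> verts G \<and> (\<forall>e \<in> edges H. f ` e \<in> edges G))"

datatype colour = Red | Blue

text \<open>
  The vertex set of \<open>K\<^sub>N\<close> is \<open>{..<N}\<close>. A colouring is a total function on sets, but only its values
  on edges are ever used.
\<close>

definition colour_class :: "nat \<Rightarrow> (nat set \<Rightarrow> colour) \<Rightarrow> colour \<Rightarrow> nat sgraph" where
  "colour_class N c k =
     \<lparr>verts = {..<N}, edges = {e \<in> edges (complete_graph {..<N}). c e = k}\<rparr>"

text \<open>
  For finite graphs \<open>G\<close> and \<open>H\<close> the least element exists by Ramsey's theorem.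
\<close>

definition ramsey_number :: "'a sgraph \<Rightarrow> 'b sgraph \<Rightarrow> nat" where
  "ramsey_number G H =
     (LEAST N. \<forall>c. contains_copy (colour_class N c Red) G \<or> contains_copy (colour_class N c Blue) H)"

end

theory Submission
  imports Defs "Jordan_Normal_Form.Schur_Decomposition"
begin

text \<open>
  Suppose a colouring of \<open>K\<^bsub>4n-3\<^esub>\<close> has neither a red \<open>B\<^bsub>n-2\<^esub>\<close> nor a blue \<open>B\<^sub>n\<close>. Counting
  monochromatic triangles as in Goodman's theorem, with red degrees \<open>2n - 2 + x\<close>, gives
  \<open>\<Sum> (3x\<^sup>2 + 2x) \<le> 0\<close>. Hence every \<open>x\<close> vanishes and all the inequalities used are equalities: the
  red graph is strongly regular with parameters \<open>(4n - 3, 2n - 2, n - 3, n)\<close>. The projection onto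
  an eigenspace of its adjacency matrix has trace \<open>2n - 2 + (4n - 4) / \<surd>(4n + 1)\<close>, which must be an
  integer; so \<open>4n + 1\<close> divides \<open>(4n - 4)\<^sup>2\<close> and therefore \<open>25\<close>, leaving only \<open>n = 6\<close>.
\<close>

section \<open>Integrality of the trace of an idempotent matrix\<close>

lemma sum_diag_mult_commute:
  fixes A B :: "'a::comm_semiring_0 mat"
  assumes "A \<in> carrier_mat n n" and "B \<in> carrier_mat n n"
  shows "(\<Sum>i<n. (A * B) $$ (i, i)) = (\<Sum>i<n. (B * A) $$ (i, i))"
proof -
  have "(\<Sum>i<n. (A * B) $$ (i, i)) = (\<Sum>i<n. \<Sum>j<n. A $$ (i, j) * B $$ (j, i))"
    using assms by (auto intro!: sum.cong simp: scalar_prod_def atLeast0LessThan)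
  also have "\<dots> = (\<Sum>j<n. \<Sum>i<n. B $$ (j, i) * A $$ (i, j))"
    by (subst sum.swap) (simp add: mult.commute)
  also have "\<dots> = (\<Sum>j<n. (B * A) $$ (j, j))"
    using assms by (auto intro!: sum.cong simp: scalar_prod_def atLeast0LessThan)
  finally show ?thesis .
qed

text \<open>A triangular matrix similar to \<open>A\<close> is again idempotent, so each of its
  diagonal entries satisfies \<open>b = b * b\<close> and is 0 or 1; the trace is invariant under
  similarity.\<close>

lemma sum_diag_idempotent_mat:
  fixes A :: "complex mat"
  assumes A: "A \<in> carrier_mat n n" and idem: "A * A = A"
  shows "(\<Sum>i<n. A $$ (i, i)) \<in> \<int>"
proof -
  obtain es where es: "char_poly A = (\<Prod>a\<leftarrow>es. [:- a, 1:])"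
    using char_poly_factorized[OF A] by auto
  obtain B P Q where "schur_decomposition A es = (B, P, Q)"
    by (cases "schur_decomposition A es") auto
  from schur_decomposition[OF A es this]
  have sim: "similar_mat_wit A B P Q" and ut: "upper_triangular B"
    by auto
  note w = similar_mat_witD2[OF A sim]
  \<comment> \<open>Reversing the similarity gives \<open>B = Q * A * P\<close>, from which
    idempotence passes to \<open>B\<close>.\<close>
  note w' = similar_mat_witD2(3)[OF w(5) similar_mat_wit_sym[OF sim]]
  have "B * B = Q * A * P * (Q * A * P)"
    using w' by simp
  also have "\<dots> = Q * A * (P * Q) * A * P"
    using A w(6,7) by (smt (verit) assoc_mult_mat mult_carrier_mat)
  also have "\<dots> = Q * (A * A) * P"
    using A w(6,7) w(1) by (metis assoc_mult_mat mult_carrier_mat right_mult_one_mat)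
  finally have BB: "B * B = B"
    using idem w' by simp
  have diag: "B $$ (i, i) \<in> \<int>" if i: "i < n" for i
  proof -
    have "B $$ (i, i) = (B * B) $$ (i, i)"
      using BB by simp
    also have "\<dots> = (\<Sum>j<n. B $$ (i, j) * B $$ (j, i))"
      using w(5) i by (auto intro!: sum.cong simp: scalar_prod_def atLeast0LessThan)
    \<comment> \<open>Triangularity kills \<open>B $$ (i, j)\<close> for \<open>j < i\<close> and
      \<open>B $$ (j, i)\<close> for \<open>j > i\<close>.\<close>
    also have "\<dots> = (\<Sum>j<n. if j = i then B $$ (i, i) * B $$ (i, i) else 0)"
    proof (intro sum.cong refl)
      fix j assume "j \<in> {..<n}"
      then show "B $$ (i, j) * B $$ (j, i) = (if j = i then B $$ (i, i) * B $$ (i, i) else 0)"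
        using ut w(5) i by (cases j i rule: linorder_cases) (auto simp: upper_triangular_def)
    qed
    also have "\<dots> = B $$ (i, i) * B $$ (i, i)"
      using i by simp
    finally show ?thesis
      by (metis Ints_0 Ints_1 mult_cancel_left1)
  qed
  have "(\<Sum>i<n. A $$ (i, i)) = (\<Sum>i<n. (P * (B * Q)) $$ (i, i))"
    using w by simp
  also have "\<dots> = (\<Sum>i<n. ((B * Q) * P) $$ (i, i))"
    using w by (intro sum_diag_mult_commute) auto
  also have "(B * Q) * P = B"
    using w by simp
  finally show ?thesis
    using diag by (auto intro!: Ints_sum)
qed

text \<open>The entries are embedded in the complex numbers, where the characteristic polynomial
  splits and the Schur decomposition is available.\<close>

lemma sum_diag_idempotent_real:
  fixes p :: "nat \<Rightarrow> nat \<Rightarrow> real"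
  assumes idem: "\<And>i j. i < N \<Longrightarrow> j < N \<Longrightarrow> (\<Sum>k<N. p i k * p k j) = p i j"
  shows "(\<Sum>i<N. p i i) \<in> \<int>"
proof -
  define A where "A = mat N N (\<lambda>(i, j). complex_of_real (p i j))"
  have A: "A \<in> carrier_mat N N"
    by (simp add: A_def)
  have "A * A = A"
  proof (rule eq_matI)
    fix i j assume "i < dim_row A" "j < dim_col A"
    then have ij: "i < N" "j < N"
      by (auto simp: A_def)
    then have "(A * A) $$ (i, j) = complex_of_real (\<Sum>k<N. p i k * p k j)"
      by (simp add: A_def scalar_prod_def atLeast0LessThan)
    then show "(A * A) $$ (i, j) = A $$ (i, j)"
      using ij idem by (simp add: A_def)
  qed (simp_all add: A_def)
  from sum_diag_idempotent_mat[OF A this]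
  have "complex_of_real (\<Sum>i<N. p i i) \<in> \<int>"
    by (simp add: A_def)
  then show ?thesis
    using of_real_in_Ints_iff by blast
qed

section \<open>Books from common neighbourhoods\<close>

text \<open>The edge \<open>{u, v}\<close> serves as the spine and \<open>m\<close> vertices chosen
  from \<open>W\<close> as the pages. In contrapositive form this bounds common
  neighbourhoods.\<close>

lemma contains_book:
  fixes G :: "nat sgraph"
  assumes uv: "u \<noteq> v" "u \<in> verts G" "v \<in> verts G" "{u, v} \<in> edges G"
    and W: "finite W" "m \<le> card W" "W \<subseteq> verts G - {u, v}"
    and adj: "\<And>w. w \<in> W \<Longrightarrow> {u, w} \<in> edges G \<and> {v, w} \<in> edges G"
  shows "contains_copy G (book_graph m)"
proof -
  obtain g where g: "g ` {..<m} \<subseteq> W" "inj_on g {..<m}"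
    using W card_le_inj[of "{..<m}" W] by auto
  define f :: "nat + nat \<Rightarrow> nat" where "f = case_sum (\<lambda>i. if i = 0 then u else v) g"
  have verts: "verts (book_graph m) = {..<2} <+> {..<m}"
    by (simp add: book_graph_def graph_join_def complete_graph_def complement_graph_def)
  have edges: "edges (book_graph m) =
      (\<lambda>e. Inl ` e) ` [{..<2}]\<^bsup>2\<^esup> \<union> {{Inl i, Inr j} | i j. i < 2 \<and> j < m}"
    by (simp add: book_graph_def graph_join_def complete_graph_def complement_graph_def)
  have gW: "g j \<in> W" if "j < m" for j
    using g that by auto
  have two: "[{..<2::nat}]\<^bsup>2\<^esup> = {{0, 1}}"
  proof -
    have "{..<2::nat} = {0, 1}"
      by auto
    then show ?thesis
      using nsets_self[of 2] by simp
  qed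
  have inj: "inj_on f ({..<2} <+> {..<m})"
  proof (rule inj_onI)
    fix x y assume xy: "x \<in> {..<2} <+> {..<m}" "y \<in> {..<2} <+> {..<m}" "f x = f y"
    have ne: "g j \<noteq> u \<and> g j \<noteq> v" if "j < m" for j
      using gW[OF that] W(3) by blast
    show "x = y"
    proof (cases x; cases y)
      fix i j assume "x = Inl i" "y = Inl j"
      then show ?thesis
        using xy uv(1) by (auto simp: f_def less_2_cases_iff split: if_splits)
    next
      fix i j assume "x = Inl i" "y = Inr j"
      then show ?thesis
        using xy ne[of j] by (auto simp: f_def split: if_splits)
    next
      fix i j assume "x = Inr i" "y = Inl j"
      then show ?thesis
        using xy ne[of i] by (auto simp: f_def split: if_splits)
    next
      fix i j assume "x = Inr i" "y = Inr j"
      then show ?thesis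
        using xy inj_onD[OF g(2), of i j] by (auto simp: f_def)
    qed
  qed
  moreover have "f ` ({..<2} <+> {..<m}) \<subseteq> verts G"
    using uv gW subsetD[OF W(3)] by (auto simp: f_def)
  moreover have "f ` e \<in> edges G" if e: "e \<in> edges (book_graph m)" for e
  proof -
    consider "e = Inl ` {0, 1}" | i j where "e = {Inl i, Inr j}" "i < 2" "j < m"
      using e unfolding edges two by auto
    then show ?thesis
    proof cases
      case 1
      then show ?thesis
        using uv by (simp add: f_def insert_commute)
    next
      case 2
      then show ?thesis
        using adj[OF gW[of j]] by (auto simp: f_def)
    qed
  qed
  ultimately show ?thesis
    unfolding contains_copy_def verts by blast
qed

section \<open>Goodman-type counting and its equality case\<close>

text \<open>Here \<open>a\<close> is the red adjacency matrix. The second conclusion is the matrix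
  identity a^2 = (n - 2) I - 3 a + n J, with J the all-ones matrix, which encodes strong
  regularity.\<close>

lemma extremal_counting:
  fixes a :: "nat \<Rightarrow> nat \<Rightarrow> real" and n :: nat
  defines "N \<equiv> 4 * n - 3"
  assumes n: "n \<ge> 1"
    and irrefl: "\<And>i. a i i = 0" and zero_one: "\<And>i j. a i j = 0 \<or> a i j = 1"
    and sym: "\<And>i j. a i j = a j i"
    and red: "\<And>i j. i < N \<Longrightarrow> j < N \<Longrightarrow> a i j = 1 \<Longrightarrow> (\<Sum>k<N. a i k * a k j) \<le> real n - 3"
    and blue: "\<And>i j. i < N \<Longrightarrow> j < N \<Longrightarrow> i \<noteq> j \<Longrightarrow> a i j = 0 \<Longrightarrow>
      (\<Sum>k<N. (1 - of_bool (i = k) - a i k) * (1 - of_bool (k = j) - a k j)) \<le> real n - 1"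
    and ij: "i < N" "j < N"
  shows "(\<Sum>k<N. a i k) = 2 * real n - 2"
    and "(\<Sum>k<N. a i k * a k j) = (real n - 2) * of_bool (i = j) - 3 * a i j + real n"
proof -
  define d where "d i = (\<Sum>k<N. a i k)" for i
  define c where "c i j = (\<Sum>k<N. a i k * a k j)" for i j
  have N: "real N = 4 * real n - 3"
    using n by (simp add: N_def)
  have sq: "a i j * a i j = a i j" for i j
    using zero_one[of i j] by auto
  have c_diag: "c i i = d i" for i
    unfolding c_def d_def by (intro sum.cong refl) (metis sq sym)
  \<comment> \<open>By inclusion-exclusion a blue edge has \<open>N - 2 - d i - d j + c i j\<close>
    common blue neighbours, so the blue bound limits the red count \<open>c i j\<close> as
    well.\<close>
  have c_blue: "c i j \<le> d i + d j + 4 - 3 * real n"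
    if that: "i < N" "j < N" "i \<noteq> j" "a i j = 0" for i j
  proof -
    have aji: "a j i = 0"
      using that sym[of i j] by simp
    have "(\<Sum>k<N. (1 - of_bool (i = k) - a i k) * (1 - of_bool (k = j) - a k j)) =
        (\<Sum>k<N. 1 + a i k * a k j - a i k - a j k
          - (if k = i then 1 else 0) - (if k = j then 1 else 0))"
    proof (intro sum.cong refl)
      fix k
      show "(1 - of_bool (i = k) - a i k) * (1 - of_bool (k = j) - a k j) =
        1 + a i k * a k j - a i k - a j k - (if k = i then 1 else 0) - (if k = j then 1 else 0)"
        using that aji irrefl[of i] irrefl[of j] sym[of k j]
        by (cases "k = i"; cases "k = j") (simp_all add: algebra_simps)
    qed
    also have "\<dots> = N + c i j - d i - d j - 2"
      using that by (simp add: sum.distrib sum_subtractf c_def d_def)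
    finally show ?thesis
      using blue[OF that] N by simp
  qed
  \<comment> \<open>\<open>b\<close> is the blue adjacency matrix, and \<open>t i j\<close> the
    slack in the upper bound for \<open>c i j\<close>: zero on the diagonal, from \<open>red\<close>
    on red edges, from \<open>c_blue\<close> on blue ones.\<close>
  define b where "b i j = 1 - of_bool (i = j) - a i j" for i j
  define t where "t i j = of_bool (i = j) * d i + a i j * (real n - 3)
    + b i j * (d i + d j + 4 - 3 * real n) - c i j" for i j
  have t_nonneg: "0 \<le> t i j" if "i < N" "j < N" for i j
  proof -
    consider "i = j" | "i \<noteq> j" "a i j = 1" | "i \<noteq> j" "a i j = 0"
      using zero_one[of i j] by blast
    then show ?thesis
    proof cases
      case 1
      then show ?thesis by (simp add: t_def b_def irrefl c_diag)
    next
      case 2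
      then show ?thesis using red[OF that] by (simp add: t_def b_def c_def)
    next
      case 3
      then show ?thesis using c_blue[OF that] by (simp add: t_def b_def)
    qed
  qed
  \<comment> \<open>Half of the \<open>N - 1\<close> other vertices is \<open>2 * n - 2\<close>, so
    \<open>x\<close> measures the imbalance between the colours at a vertex.\<close>
  define x where "x i = d i - (2 * real n - 2)" for i
  have sum_a: "(\<Sum>j<N. a j i) = d i" for i
    unfolding d_def by (intro sum.cong refl sym)
  have sum_b_row: "(\<Sum>j<N. b i j) = 4 * real n - 4 - d i" if "i < N" for i
    using that N by (simp add: b_def sum_subtractf d_def of_bool_def)
  have sum_b_col: "(\<Sum>j<N. b j i) = 4 * real n - 4 - d i" if "i < N" for i
    using that N by (simp add: b_def sum_subtractf sum_a of_bool_def)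
  \<comment> \<open>Exchanging the sums makes \<open>d j\<close> a constant factor, leaving a column
    sum of \<open>b\<close>.\<close>
  have "(\<Sum>i<N. \<Sum>j<N. b i j * d j) = (\<Sum>j<N. \<Sum>i<N. b i j * d j)"
    by (rule sum.swap)
  also have "\<dots> = (\<Sum>j<N. (4 * real n - 4 - d j) * d j)"
    by (intro sum.cong refl) (simp add: sum_b_col flip: sum_distrib_right)
  finally have sum_bd: "(\<Sum>i<N. \<Sum>j<N. b i j * d j) = (\<Sum>i<N. (4 * real n - 4 - d i) * d i)" .
  have "(\<Sum>i<N. \<Sum>j<N. c i j) = (\<Sum>i<N. \<Sum>k<N. \<Sum>j<N. a i k * a k j)"
    unfolding c_def by (intro sum.cong refl sum.swap)
  also have "\<dots> = (\<Sum>i<N. \<Sum>k<N. a i k * d k)"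
    by (simp add: d_def sum_distrib_left)
  also have "\<dots> = (\<Sum>k<N. \<Sum>i<N. a i k * d k)"
    by (rule sum.swap)
  also have "\<dots> = (\<Sum>i<N. d i * d i)"
    by (simp add: sum_a flip: sum_distrib_right)
  finally have sum_c: "(\<Sum>i<N. \<Sum>j<N. c i j) = (\<Sum>i<N. d i * d i)" .
  have t_row: "(\<Sum>j<N. t i j) = d i + d i * (real n - 3)
      + (4 * real n - 4 - d i) * (d i + 4 - 3 * real n) + (\<Sum>j<N. b i j * d j) - (\<Sum>j<N. c i j)"
    if "i < N" for i
  proof -
    have "(\<Sum>j<N. t i j) = (\<Sum>j<N. (if j = i then d i else 0) + a i j * (real n - 3)
      + b i j * (d i + 4 - 3 * real n) + b i j * d j - c i j)"
      by (intro sum.cong refl) (auto simp: t_def algebra_simps)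
    also have "\<dots> = d i + (\<Sum>j<N. a i j) * (real n - 3)
      + (\<Sum>j<N. b i j) * (d i + 4 - 3 * real n) + (\<Sum>j<N. b i j * d j) - (\<Sum>j<N. c i j)"
      using that by (simp add: sum.distrib sum_subtractf sum_distrib_right)
    finally show ?thesis
      using sum_b_row[OF that] by (simp add: d_def)
  qed
  have "(\<Sum>i<N. \<Sum>j<N. t i j) = (\<Sum>i<N. d i + d i * (real n - 3)
      + (4 * real n - 4 - d i) * (d i + 4 - 3 * real n))
      + (\<Sum>i<N. (4 * real n - 4 - d i) * d i) - (\<Sum>i<N. d i * d i)"
    unfolding sum_bd[symmetric] sum_c[symmetric] sum.distrib[symmetric] sum_subtractf[symmetric]
    by (intro sum.cong refl) (simp add: t_row sum.distrib sum_subtractf)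
  also have "\<dots> = (\<Sum>i<N. - (3 * x i ^ 2 + 2 * x i))"
    unfolding sum.distrib[symmetric] sum_subtractf[symmetric] x_def
    by (intro sum.cong refl) (simp add: power2_eq_square algebra_simps)
  finally have total: "(\<Sum>i<N. \<Sum>j<N. t i j) + (\<Sum>i<N. 3 * x i ^ 2 + 2 * x i) = 0"
    unfolding sum_negf by linarith
  have x_Ints: "x i \<in> \<int>" for i
  proof -
    have "a i j \<in> \<int>" for j
      using zero_one[of i j] by auto
    then show ?thesis
      unfolding x_def d_def by (intro Ints_diff Ints_sum Ints_mult) auto
  qed
  \<comment> \<open>As \<open>x i\<close> is an integer, \<open>3 x\<^sup>2 + 2 x\<close> is nonnegative and vanishes only at \<open>0\<close>.\<close>
  have x_bound: "\<bar>x i\<bar> \<le> 3 * x i ^ 2 + 2 * x i" for i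
  proof -
    have "x i = 0 \<or> \<bar>x i\<bar> \<ge> 1"
      using x_Ints Ints_nonzero_abs_ge1 by blast
    then have "\<bar>x i\<bar> \<le> \<bar>x i\<bar> * \<bar>x i\<bar>"
      using mult_left_mono[of 1 "\<bar>x i\<bar>" "\<bar>x i\<bar>"] by auto
    then have "\<bar>x i\<bar> \<le> x i ^ 2"
      by (simp add: power2_eq_square)
    then show ?thesis
      by linarith
  qed
  have x_nonneg: "0 \<le> 3 * x i ^ 2 + 2 * x i" for i
    using x_bound[of i] by linarith
  have row_nonneg: "0 \<le> (\<Sum>j<N. t i j)" if "i < N" for i
    using t_nonneg that by (intro sum_nonneg) auto
  have "(\<Sum>i<N. \<Sum>j<N. t i j) \<ge> 0" "(\<Sum>i<N. 3 * x i ^ 2 + 2 * x i) \<ge> 0"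
    by (rule sum_nonneg, simp add: row_nonneg) (rule sum_nonneg, rule x_nonneg)
  \<comment> \<open>Two nonnegative sums add up to zero, so every imbalance and every slack
    vanishes.\<close>
  with total have sums0: "(\<Sum>i<N. \<Sum>j<N. t i j) = 0" "(\<Sum>i<N. 3 * x i ^ 2 + 2 * x i) = 0"
    by linarith+
  have x0: "x i = 0" if "i < N" for i
  proof -
    have "3 * x i ^ 2 + 2 * x i = 0"
      using sums0(2) x_nonneg that by (subst (asm) sum_nonneg_eq_0_iff) auto
    then show ?thesis
      using x_bound[of i] by linarith
  qed
  have "(\<Sum>j<N. t i j) = 0"
    using sums0(1) row_nonneg ij by (subst (asm) sum_nonneg_eq_0_iff) auto
  then have t0: "t i j = 0"
    using t_nonneg ij by (subst (asm) sum_nonneg_eq_0_iff) auto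
  have d: "d i = 2 * real n - 2" "d j = 2 * real n - 2"
    using ij x0[of i] x0[of j] by (auto simp: x_def)
  show "(\<Sum>k<N. a i k) = 2 * real n - 2"
    using d by (simp add: d_def)
  have "c i j = (real n - 2) * of_bool (i = j) - 3 * a i j + real n"
    using t0 d irrefl by (cases "i = j") (auto simp: t_def b_def algebra_simps)
  then show "(\<Sum>k<N. a i k * a k j) = (real n - 2) * of_bool (i = j) - 3 * a i j + real n"
    by (simp add: c_def)
qed

section \<open>Integrality of an eigenvalue multiplicity\<close>

lemma strongly_regular_order:
  fixes a :: "nat \<Rightarrow> nat \<Rightarrow> real" and n :: nat
  defines "N \<equiv> 4 * n - 3"
  assumes n: "n \<ge> 3"
    and irrefl: "\<And>i. a i i = 0" and sym: "\<And>i j. a i j = a j i"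
    and degree: "\<And>i. i < N \<Longrightarrow> (\<Sum>k<N. a i k) = 2 * real n - 2"
    and square: "\<And>i j. i < N \<Longrightarrow> j < N \<Longrightarrow>
      (\<Sum>k<N. a i k * a k j) = (real n - 2) * of_bool (i = j) - 3 * a i j + real n"
  shows "n = 6"
proof -
  \<comment> \<open>On vectors orthogonal to the all-ones vector, \<open>square\<close> says
    \<theta>^2 + 3 \<theta> - (n - 2) = 0 for every eigenvalue \<theta>, with roots (-3 + s) / 2 and
    (-3 - s) / 2; \<open>s\<close> is their difference.\<close>
  define s where "s = sqrt (4 * real n + 1)"
  have s: "s > 0" and s2: "s ^ 2 = 4 * real n + 1"
    by (simp_all add: s_def)
  have N: "real N = 4 * real n - 3" "real N > 0"
    using n by (simp_all add: N_def)
  \<comment> \<open>With \<theta>' = (-3 - s) / 2, these are the coefficients of I, J and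
    \<open>a\<close> in (a - \<theta>' I - ((2n - 2 - \<theta>') / N) J) / s, which vanishes on the
    all-ones vector and on the eigenspace of \<theta>'.\<close>
  define \<alpha> \<beta> \<gamma> where "\<alpha> = (1 + 3 / s) / 2"
    and "\<beta> = - (1 + (4 * real n - 1) / s) / (2 * real N)" and "\<gamma> = 1 / s"
  \<comment> \<open>The orthogonal projection onto the eigenspace of \<open>a\<close> for the eigenvalue \<open>(s - 3) / 2\<close>.\<close>
  define p where "p i j = \<alpha> * of_bool (i = j) + \<beta> + \<gamma> * a i j" for i j
  \<comment> \<open>These are the coefficients of I, \<open>a\<close> and J in the identity p^2 = p.
    Writing \<open>n\<close> and \<open>N\<close> through \<open>s\<close> makes them rational
    identities in \<open>s\<close>.\<close>
  have coeffs: "\<alpha>\<^sup>2 + \<gamma>\<^sup>2 * (real n - 2) = \<alpha>" "2 * \<alpha> * \<gamma> - 3 * \<gamma>\<^sup>2 = \<gamma>"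
    "2 * \<alpha> * \<beta> + \<beta>\<^sup>2 * real N + 2 * \<beta> * \<gamma> * (2 * real n - 2) + \<gamma>\<^sup>2 * real n = \<beta>"
  proof -
    have n_eq: "real n = (s\<^sup>2 - 1) / 4"
      using s2 by simp
    show "\<alpha>\<^sup>2 + \<gamma>\<^sup>2 * (real n - 2) = \<alpha>"
      using s unfolding \<alpha>_def \<gamma>_def n_eq by (simp add: field_simps power2_eq_square)
    show "2 * \<alpha> * \<gamma> - 3 * \<gamma>\<^sup>2 = \<gamma>"
      using s unfolding \<alpha>_def \<gamma>_def by (simp add: field_simps power2_eq_square)
    have N': "real N = s\<^sup>2 - 4"
      using N s2 by simp
    then have "s\<^sup>2 - 4 \<noteq> 0"
      using N by simp
    then show "2 * \<alpha> * \<beta> + \<beta>\<^sup>2 * real N + 2 * \<beta> * \<gamma> * (2 * real n - 2) + \<gamma>\<^sup>2 * real n = \<beta>"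
      using s unfolding \<alpha>_def \<beta>_def \<gamma>_def n_eq N'
      by (simp add: divide_simps) (simp add: algebra_simps power2_eq_square)
  qed
  have "(\<Sum>k<N. p i k * p k j) = p i j" if "i < N" "j < N" for i j
  proof -
    have "(\<Sum>k<N. p i k * p k j) =
      (\<Sum>k<N. (if k = i then \<alpha>\<^sup>2 * of_bool (i = j) + \<alpha> * \<beta> + \<alpha> * \<gamma> * a i j else 0)
        + (if k = j then \<alpha> * \<beta> + \<alpha> * \<gamma> * a i j else 0) + \<beta>\<^sup>2 + \<beta> * \<gamma> * a i k + \<beta> * \<gamma> * a j k
        + \<gamma>\<^sup>2 * (a i k * a k j))"
    proof (intro sum.cong refl)
      fix k
      show "p i k * p k j = (if k = i then \<alpha>\<^sup>2 * of_bool (i = j) + \<alpha> * \<beta> + \<alpha> * \<gamma> * a i j else 0)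
        + (if k = j then \<alpha> * \<beta> + \<alpha> * \<gamma> * a i j else 0) + \<beta>\<^sup>2 + \<beta> * \<gamma> * a i k + \<beta> * \<gamma> * a j k
        + \<gamma>\<^sup>2 * (a i k * a k j)"
        using sym[of j k]
        by (cases "k = i"; cases "k = j")
          (simp_all add: p_def irrefl algebra_simps power2_eq_square)
    qed
    also have "\<dots> = \<alpha>\<^sup>2 * of_bool (i = j) + 2 * \<alpha> * \<beta> + 2 * \<alpha> * \<gamma> * a i j + \<beta>\<^sup>2 * real N
      + 2 * \<beta> * \<gamma> * (2 * real n - 2) + \<gamma>\<^sup>2 * ((real n - 2) * of_bool (i = j) - 3 * a i j + real n)"
      using that by (simp add: sum.distrib degree square flip: sum_distrib_left)
    also have "\<dots> = (\<alpha>\<^sup>2 + \<gamma>\<^sup>2 * (real n - 2)) * of_bool (i = j)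
      + (2 * \<alpha> * \<beta> + \<beta>\<^sup>2 * real N + 2 * \<beta> * \<gamma> * (2 * real n - 2) + \<gamma>\<^sup>2 * real n)
      + (2 * \<alpha> * \<gamma> - 3 * \<gamma>\<^sup>2) * a i j"
      by (simp add: algebra_simps)
    finally show ?thesis
      unfolding coeffs p_def .
  qed
  then have "(\<Sum>i<N. p i i) \<in> \<int>"
    by (rule sum_diag_idempotent_real)
  also have "(\<Sum>i<N. p i i) = real N * (\<alpha> + \<beta>)"
    by (simp add: p_def irrefl)
  also have "\<dots> = 2 * real n - 2 + (4 * real n - 4) / s"
    using s N(2) unfolding \<alpha>_def \<beta>_def
    by (simp add: divide_simps) (simp add: N algebra_simps)
  finally have "2 * real n - 2 + (4 * real n - 4) / s - (2 * real n - 2) \<in> \<int>"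
    by (rule Ints_diff) simp
  then obtain q where q: "(4 * real n - 4) / s = of_int q"
    by (auto elim: Ints_cases)
  then have "of_int q * s = 4 * real n - 4"
    using s by (simp add: field_simps)
  then have "(4 * real n - 4) ^ 2 = of_int q ^ 2 * (4 * real n + 1)"
    by (metis power_mult_distrib s2)
  then have "real_of_int ((4 * int n - 4) ^ 2) = real_of_int (q ^ 2 * (4 * int n + 1))"
    by simp
  then have "(4 * int n - 4) ^ 2 = q ^ 2 * (4 * int n + 1)"
    by (simp only: of_int_eq_iff)
  \<comment> \<open>With m = 4n + 1, (4n - 4)^2 = (m - 5)^2 = m (m - 10) + 25.\<close>
  then have "25 = (4 * int n + 1) * (q ^ 2 - 4 * int n + 9)"
    by (simp add: algebra_simps power2_eq_square)
  then have dvd: "4 * int n + 1 dvd 25"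
    by (metis dvd_triv_left)
  then have "4 * int n + 1 \<le> 25"
    by (intro zdvd_imp_le) auto
  then have "n = 3 \<or> n = 4 \<or> n = 5 \<or> n = 6"
    using n by linarith
  \<comment> \<open>The candidates for 4n + 1 are 13, 17, 21 and 25, of which only 25 divides
    25.\<close>
  then show "n = 6"
    using dvd by auto
qed

section \<open>From a colouring without the books to the extremal graph\<close>

theorem theorem1p2:
  fixes n :: nat
  assumes "n \<ge> 3" and "n \<noteq> 6"
  shows "ramsey_number (book_graph (n - 2)) (book_graph n) \<le> 4 * n - 3"
proof -
  define N where "N = 4 * n - 3"
  have "contains_copy (colour_class N c Red) (book_graph (n - 2)) \<or>
    contains_copy (colour_class N c Blue) (book_graph n)" for c
  proof (rule ccontr)
    assume neg: "\<not> ?thesis"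
    \<comment> \<open>The guard \<open>i \<noteq> j\<close> matters because \<open>{i, i}\<close> is
      a singleton, on which \<open>c\<close> may still take the value \<open>Red\<close>.\<close>
    define a :: "nat \<Rightarrow> nat \<Rightarrow> real" where "a i j = of_bool (i \<noteq> j \<and> c {i, j} = Red)" for i j
    define common where
      "common col i j = {k. k < N \<and> k \<noteq> i \<and> k \<noteq> j \<and> c {i, k} = col \<and> c {j, k} = col}" for col i j
    have small: "card (common col i j) < m"
      if "\<not> contains_copy (colour_class N c col) (book_graph m)" "i < N" "j < N" "i \<noteq> j" "c {i, j} = col"
      for col m i j
    proof (rule ccontr)
      assume "\<not> ?thesis"
      then have "contains_copy (colour_class N c col) (book_graph m)"
        using that by (intro contains_book[of i j _ "common col i j"])
          (auto simp: common_def colour_class_def complete_graph_def)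
      with that show False
        by blast
    qed
    have card: "(\<Sum>k<N. of_bool (k \<noteq> i \<and> k \<noteq> j \<and> c {i, k} = col \<and> c {j, k} = col)) =
        real (card (common col i j))" for col i j
    proof -
      have "common col i j = {..<N} \<inter> {k. k \<noteq> i \<and> k \<noteq> j \<and> c {i, k} = col \<and> c {j, k} = col}"
        by (auto simp: common_def)
      then show ?thesis
        by (simp add: sum_of_bool_eq)
    qed
    have red: "(\<Sum>k<N. a i k * a k j) \<le> real n - 3" if "i < N" "j < N" "a i j = 1" for i j
    proof -
      have "(\<Sum>k<N. a i k * a k j) =
          (\<Sum>k<N. of_bool (k \<noteq> i \<and> k \<noteq> j \<and> c {i, k} = Red \<and> c {j, k} = Red))"
        by (intro sum.cong refl) (auto simp: a_def insert_commute)
      moreover have "card (common Red i j) < n - 2"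
        using neg that by (intro small) (auto simp: a_def of_bool_def split: if_splits)
      ultimately show ?thesis
        using assms by (simp add: card)
    qed
    have blue: "(\<Sum>k<N. (1 - of_bool (i = k) - a i k) * (1 - of_bool (k = j) - a k j)) \<le> real n - 1"
      if "i < N" "j < N" "i \<noteq> j" "a i j = 0" for i j
    proof -
      have not_red: "x = Blue \<longleftrightarrow> x \<noteq> Red" for x
        by (cases x) auto
      \<comment> \<open>Each factor is the indicator of a blue edge, since \<open>c\<close> takes
        only two values.\<close>
      have "(\<Sum>k<N. (1 - of_bool (i = k) - a i k) * (1 - of_bool (k = j) - a k j)) =
          (\<Sum>k<N. of_bool (k \<noteq> i \<and> k \<noteq> j \<and> c {i, k} = Blue \<and> c {j, k} = Blue))"
        by (intro sum.cong refl) (auto simp: a_def not_red insert_commute)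
      moreover have "card (common Blue i j) < n"
        using neg that by (intro small) (auto simp: a_def not_red)
      ultimately show ?thesis
        by (simp add: card)
    qed
    have a: "a i i = 0" "a i j = 0 \<or> a i j = 1" "a i j = a j i" for i j
      by (auto simp: a_def insert_commute)
    have "n \<ge> 1"
      using assms by simp
    note extremal = extremal_counting[of n a, folded N_def, OF this a red blue]
    have "n = 6"
      by (rule strongly_regular_order[of n a, folded N_def, OF assms(1) a(1,3) extremal(1) extremal(2)])
    with assms show False
      by simp
  qed
  then show ?thesis
    unfolding ramsey_number_def N_def by (intro Least_le) blast
qed

end
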